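(* Let $a_1,b_1,a_2,b_2,a_3,b_3$ be real numbers satisfying condition $(\Omega)$ (defined in the context), and consider branching on $x_1$. For $c_1\in[a_1,b_1]$ let $$T_1(c_1)=\operatorname{vol}\big(\mathcal{P}_h([a_1,c_1]\times[a_2,b_2]\times[a_3,b_3])\big)+\operatorname{vol}\big(\mathcal{P}_h([c_1,b_1]\times[a_2,b_2]\times[a_3,b_3])\big)$$ be the sum of the volumes of the convex-hull relaxations of the two children. Put $$q_2=\frac{a_1+b_1}{2},\qquad q_3=\frac{4a_1a_2a_3-4a_1b_2b_3+3b_1a_2a_3+b_1a_2b_3-b_1b_2a_3-3b_1b_2b_3}{2(4a_2a_3-b_2a_3-3b_2b_3)}.$$ Define $c^*$ by the following procedure. 1. If $a_2=0$, then $c^*=q_2$. 2. If $a_2\neq 0$ and $\frac{b_1a_2}{b_2}\le\frac{a_1b_2}{a_2}$: if $q_3\ge \frac{a_1b_2}{a_2}$ then $c^*=q_3$; otherwise, if $\frac{b_1a_2}{b_2}\le q_2\le\frac{a_1b_2}{a_2}$ then $c^*=q_2$; otherwise $c^*=\frac{a_1b_2}{a_2}$. 3. If $a_2\neq 0$ and $\frac{b_1a_2}{b_2}>\frac{a_1b_2}{a_2}$: if $q_3\ge \frac{b_1a_2}{b_2}$ then $c^*=q_3$; otherwise, if $\frac{a_1b_2}{a_2}\le q_2\le\frac{b_1a_2}{b_2}$ then $c^*=q_2$; otherwise $c^*=\frac{b_1a_2}{b_2}$. Then $c^*$ is the optimal branching point for $x_1$, i.e. $c^*\in[a_1,b_1]$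 and $T_1(c^* )=\min_{c_1\in[a_1,b_1]}T_1(c_1)$.
   Context: Condition $(\Omega)$ on real numbers $a_1,b_1,a_2,b_2,a_3,b_3$: $0\le a_i<b_i$ for $i=1,2,3$, and $a_1b_2b_3+b_1a_2a_3\le b_1a_2b_3+a_1b_2a_3\le b_1b_2a_3+a_1a_2b_3$ (equivalently, $\frac{a_1}{b_1}\le\frac{a_2}{b_2}\le\frac{a_3}{b_3}$). For a box $B=[l_1,u_1]\times[l_2,u_2]\times[l_3,u_3]\subset\mathbb{R}^3$ with $0\le l_i\le u_i$, let $\mathcal{P}_h(B)=\operatorname{conv}\{(f,x_1,x_2,x_3)\in\mathbb{R}^4: f=x_1x_2x_3,\ (x_1,x_2,x_3)\in B\}$ (the convex-hull relaxation of the trilinear monomial $x_1x_2x_3$ on $B$), and let $\operatorname{vol}$ denote $4$-dimensional Lebesgue measure. Branching on $x_1$ at $c_1\in[a_1,b_1]$ produces two children, in which the domain of $x_1$ is $[a_1,c_1]$ and $[c_1,b_1]$ respectively, the other domains being unchanged. *)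

theory Defs
  imports "HOL-Analysis.Analysis"
begin

definition Omega :: "real \<Rightarrow> real \<Rightarrow> real \<Rightarrow> real \<Rightarrow> real \<Rightarrow> real \<Rightarrow> bool" where
  "Omega a1 b1 a2 b2 a3 b3 \<longleftrightarrow>
     0 \<le> a1 \<and> a1 < b1 \<and> 0 \<le> a2 \<and> a2 < b2 \<and> 0 \<le> a3 \<and> a3 < b3 \<and>
     a1 * b2 * b3 + b1 * a2 * a3 \<le> b1 * a2 * b3 + a1 * b2 * a3 \<and>
     b1 * a2 * b3 + a1 * b2 * a3 \<le> b1 * b2 * a3 + a1 * a2 * b3"

lemma Omega_iff_ratios:
  "Omega a1 b1 a2 b2 a3 b3 \<longleftrightarrow>
     0 \<le> a1 \<and> a1 < b1 \<and> 0 \<le> a2 \<and> a2 < b2 \<and> 0 \<le> a3 \<and> a3 < b3 \<and>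
     a1 / b1 \<le> a2 / b2 \<and> a2 / b2 \<le> a3 / b3"
proof (cases "0 \<le> a1 \<and> a1 < b1 \<and> 0 \<le> a2 \<and> a2 < b2 \<and> 0 \<le> a3 \<and> a3 < b3")
  case True
  have "a1 * b2 * b3 + b1 * a2 * a3 \<le> b1 * a2 * b3 + a1 * b2 * a3 \<longleftrightarrow>
      (a1 * b2) * (b3 - a3) \<le> (a2 * b1) * (b3 - a3)"
    by (simp add: algebra_simps)
  also have "\<dots> \<longleftrightarrow> a1 / b1 \<le> a2 / b2"
    using True by (simp add: mult_le_cancel_right divide_simps)
  finally have 1: "a1 * b2 * b3 + b1 * a2 * a3 \<le> b1 * a2 * b3 + a1 * b2 * a3 \<longleftrightarrow> a1 / b1 \<le> a2 / b2" .
  have "b1 * a2 * b3 + a1 * b2 * a3 \<le> b1 * b2 * a3 + a1 * a2 * b3 \<longleftrightarrow>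
      (a2 * b3) * (b1 - a1) \<le> (a3 * b2) * (b1 - a1)"
    by (simp add: algebra_simps)
  also have "\<dots> \<longleftrightarrow> a2 / b2 \<le> a3 / b3"
    using True by (simp add: mult_le_cancel_right divide_simps)
  finally show ?thesis using 1 unfolding Omega_def by blast
qed (auto simp: Omega_def)

text \<open>
  Four-space is the iterated product of \<^typ>\<open>real\<close>, on which \<^const>\<open>lebesgue\<close> is
  four-dimensional Lebesgue measure.
\<close>

definition P_h :: "(real \<times> real \<times> real) set \<Rightarrow> (real \<times> real \<times> real \<times> real) set" where
  "P_h B = convex hull {(f, x1, x2, x3). f = x1 * x2 * x3 \<and> (x1, x2, x3) \<in> B}"

lemma compact_P_h:
  assumes "compact B"
  shows "compact (P_h B)"
proof -
  have "{(f, x1, x2, x3). f = x1 * x2 * x3 \<and> (x1, x2, x3) \<in> B} =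
      (\<lambda>x. (fst x * fst (snd x) * snd (snd x), x)) ` B"
    by force
  moreover have "compact ((\<lambda>x. (fst x * fst (snd x) * snd (snd x), x)) ` B)"
    by (intro compact_continuous_image continuous_intros assms)
  ultimately show ?thesis
    unfolding P_h_def by (simp add: compact_convex_hull)
qed

text \<open>
  \<^const>\<open>measure\<close> returns 0 on sets that are not measurable or have infinite measure; neither
  happens for the relaxation over a box.
\<close>

lemma lmeasurable_P_h_box:
  "P_h ({l1..u1} \<times> {l2..u2} \<times> {l3..u3}) \<in> lmeasurable"
  by (intro lmeasurable_compact compact_P_h compact_Times compact_Icc)

definition T1 :: "real \<Rightarrow> real \<Rightarrow> real \<Rightarrow> real \<Rightarrow> real \<Rightarrow> real \<Rightarrow> real \<Rightarrow> real" where
  "T1 a1 b1 a2 b2 a3 b3 c1 =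
     measure lebesgue (P_h ({a1..c1} \<times> {a2..b2} \<times> {a3..b3})) +
     measure lebesgue (P_h ({c1..b1} \<times> {a2..b2} \<times> {a3..b3}))"

definition q2 :: "real \<Rightarrow> real \<Rightarrow> real" where
  "q2 a1 b1 = (a1 + b1) / 2"

definition q3 :: "real \<Rightarrow> real \<Rightarrow> real \<Rightarrow> real \<Rightarrow> real \<Rightarrow> real \<Rightarrow> real" where
  "q3 a1 b1 a2 b2 a3 b3 =
     (4 * a1 * a2 * a3 - 4 * a1 * b2 * b3 + 3 * b1 * a2 * a3 + b1 * a2 * b3
        - b1 * b2 * a3 - 3 * b1 * b2 * b3)
     / (2 * (4 * a2 * a3 - b2 * a3 - 3 * b2 * b3))"

definition c_star :: "real \<Rightarrow> real \<Rightarrow> real \<Rightarrow> real \<Rightarrow> real \<Rightarrow> real \<Rightarrow> real" where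
  "c_star a1 b1 a2 b2 a3 b3 =
     (if a2 = 0 then q2 a1 b1
      else if b1 * a2 / b2 \<le> a1 * b2 / a2 then
        (if q3 a1 b1 a2 b2 a3 b3 \<ge> a1 * b2 / a2 then q3 a1 b1 a2 b2 a3 b3
         else if b1 * a2 / b2 \<le> q2 a1 b1 \<and> q2 a1 b1 \<le> a1 * b2 / a2 then q2 a1 b1
         else a1 * b2 / a2)
      else
        (if q3 a1 b1 a2 b2 a3 b3 \<ge> b1 * a2 / b2 then q3 a1 b1 a2 b2 a3 b3
         else if a1 * b2 / a2 \<le> q2 a1 b1 \<and> q2 a1 b1 \<le> b1 * a2 / b2 then q2 a1 b1
         else b1 * a2 / b2))"

end

theory Submission
  imports Defs
begin

text \<open>
  The proof computes the volume of the relaxation over an arbitrary box and then minimises an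
  explicit function of one variable.

  Scaling the box to the unit cube turns \<open>x\<^sub>1 * x\<^sub>2 * x\<^sub>3\<close>, up to an affine function, into a trilinear form
  \<open>p y z + q x z + r x y + d x y z\<close> with nonnegative coefficients. Its convex hull is the region
  between a convex and a concave piecewise linear function (\<open>convex_hull_trilinear\<close>). The upper
  function is linear on the six simplices in which the order of the coordinates is constant; the
  lower one is linear on six other simplices, and which ones depends on which of \<open>p\<close>, \<open>q\<close>, \<open>r\<close> is
  the least. Both functions are combinations of minima and positive parts of sums of coordinates,
  whose integrals over the cube are elementary. By Cavalieri's principle the volume is
  \<open>d (5 d + 4 (p + q + r) - 2 min p q r) / 24\<close> (\<open>measure_P_h_box\<close>), where the first factor \<open>d\<close> is the
  volume of the box.

  Under \<open>Omega\<close> the third variable never has the smallest ratio alone, so in each child the minimum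
  is taken over two expressions that are affine in the branching point. If \<open>a2 = 0\<close>, the minima
  vanish and the total volume is a quadratic with vertex \<open>q2\<close>. Otherwise the total is quadratic on
  each interval delimited by the breakpoints \<open>a1 * b2 / a2\<close> and \<open>b1 * a2 / b2\<close>, at which the smallest
  ratio passes from one variable to another. As the minima are subtracted, the total is the
  maximum of these quadratics, all of which are convex. The vertex is \<open>q2\<close> if the same variable
  has the smallest ratio in both children, and \<open>q3\<close> if it is the first variable in the left child
  and the second one in the right child. The remaining quadratic is the largest only to the left
  of both breakpoints, and the optimum is not there: the midpoint \<open>q2\<close> is at least the geometric
  mean of \<open>a1\<close> and \<open>b1\<close>, which is also that of the breakpoints, and hence at least the smaller
  breakpoint (\<open>optimal_branching_point\<close>).
\<close>

section \<open>Envelopes of a trilinear form on the unit cube\<close>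

text \<open>
  After an affine change of variables taking a box to the unit cube, \<open>x\<^sub>1 * x\<^sub>2 * x\<^sub>3\<close> is an affine
  function plus such a form, with nonnegative coefficients if the box lies in the nonnegative
  orthant.
\<close>

definition trilinear :: "real \<Rightarrow> real \<Rightarrow> real \<Rightarrow> real \<Rightarrow> real \<times> real \<times> real \<Rightarrow> real" where
  "trilinear p q r d = (\<lambda>(x, y, z). p * (y * z) + q * (x * z) + r * (x * y) + d * (x * y * z))"

text \<open>
  With nonnegative coefficients the form is supermodular on the vertices of the cube, so its
  concave envelope is the Lovasz extension of its vertex values: the function that is linear on
  each of the six simplices obtained by sorting the coordinates.
\<close>

definition conc_env :: "real \<Rightarrow> real \<Rightarrow> real \<Rightarrow> real \<Rightarrow> real \<times> real \<times> real \<Rightarrow> real" where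
  "conc_env p q r d = (\<lambda>(x, y, z).
     p * min y z + q * min x z + r * min x y + d * min x (min y z))"

text \<open>
  With \<open>m\<close> the least of the three bilinear coefficients, the form splits as
  \<open>m * (y * z + x * z + x * y)\<close> plus \<open>d * x * y * z\<close> plus multiples of two of the products of two
  coordinates. Each summand is replaced by its own convex envelope. The sum of the envelopes is
  the envelope of the sum because all of them are linear on the cells of one common
  triangulation.
\<close>

definition conv_env :: "real \<Rightarrow> real \<Rightarrow> real \<Rightarrow> real \<Rightarrow> real \<times> real \<times> real \<Rightarrow> real" where
  "conv_env p q r d = (\<lambda>(x, y, z). let m = min p (min q r) in
     m * (max 0 (x + y + z - 1) + max 0 (x + y + z - 2)) + d * max 0 (x + y + z - 2)
     + (p - m) * max 0 (y + z - 1) + (q - m) * max 0 (x + z - 1) + (r - m) * max 0 (x + y - 1))"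

lemma convex_barycentric4:
  assumes "convex C" "P1 \<in> C" "P2 \<in> C" "P3 \<in> C" "P4 \<in> C"
    and "0 \<le> u1" "0 \<le> u2" "0 \<le> u3" "0 \<le> u4" "u1 + u2 + u3 + u4 = 1"
  shows "u1 *\<^sub>R P1 + u2 *\<^sub>R P2 + u3 *\<^sub>R P3 + u4 *\<^sub>R P4 \<in> C"
proof -
  define P u where "P = (\<lambda>i::nat. [P1, P2, P3, P4] ! i)" and "u = (\<lambda>i::nat. [u1, u2, u3, u4] ! i)"
  have 4: "{..<4} = {0, 1, 2, 3 :: nat}" by auto
  have "(\<Sum>i<4. u i *\<^sub>R P i) \<in> C"
    by (rule convex_sum) (use assms in \<open>auto simp: 4 P_def u_def numeral_2_eq_2 numeral_3_eq_3\<close>)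
  then show ?thesis
    by (simp add: 4 P_def u_def numeral_2_eq_2 numeral_3_eq_3 add.assoc)
qed

text \<open>
  Sorting the coordinates writes \<open>(x, y, z)\<close> as a convex combination of a chain of vertices from
  the origin to \<open>(1, 1, 1)\<close>; the successive differences of the sorted coordinates are the weights.
  With these weights the vertex values of the form average to \<^const>\<open>conc_env\<close>.
\<close>

lemma conc_env_in_convex:
  assumes C: "convex C"
    and V: "(0, 0, 0, 0) \<in> C" "(0, 1, 0, 0) \<in> C" "(0, 0, 1, 0) \<in> C" "(0, 0, 0, 1) \<in> C"
      "(p, 0, 1, 1) \<in> C" "(q, 1, 0, 1) \<in> C" "(r, 1, 1, 0) \<in> C" "(p + q + r + d, 1, 1, 1) \<in> C"
    and xyz: "x \<in> {0..1}" "y \<in> {0..1}" "z \<in> {0..1::real}"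
  shows "(conc_env p q r d (x, y, z), x, y, z) \<in> C"
proof -
  note bary = convex_barycentric4[OF C V(1) _ _ V(8)]
  consider "z \<le> y" "y \<le> x" "z \<le> x" | "y \<le> z" "z \<le> x" "y \<le> x"
    | "z \<le> x" "x \<le> y" "z \<le> y" | "x \<le> z" "z \<le> y" "x \<le> y"
    | "y \<le> x" "x \<le> z" "y \<le> z" | "x \<le> y" "y \<le> z" "x \<le> z" by linarith
  then show ?thesis
  proof cases
    case 1
    then show ?thesis
      using bary[OF V(2,7), of "1 - x" "x - y" "y - z" z] xyz
      by (auto simp: conc_env_def algebra_simps min_absorb1 min_absorb2)
  next
    case 2
    then show ?thesis
      using bary[OF V(2,6), of "1 - x" "x - z" "z - y" y] xyz
      by (auto simp: conc_env_def algebra_simps min_absorb1 min_absorb2)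
  next
    case 3
    then show ?thesis
      using bary[OF V(3,7), of "1 - y" "y - x" "x - z" z] xyz
      by (auto simp: conc_env_def algebra_simps min_absorb1 min_absorb2)
  next
    case 4
    then show ?thesis
      using bary[OF V(3,5), of "1 - y" "y - z" "z - x" x] xyz
      by (auto simp: conc_env_def algebra_simps min_absorb1 min_absorb2)
  next
    case 5
    then show ?thesis
      using bary[OF V(4,6), of "1 - z" "z - x" "x - y" y] xyz
      by (auto simp: conc_env_def algebra_simps min_absorb1 min_absorb2)
  next
    case 6
    then show ?thesis
      using bary[OF V(4,5), of "1 - z" "z - y" "y - x" x] xyz
      by (auto simp: conc_env_def algebra_simps min_absorb1 min_absorb2)
  qed
qed

text \<open>
  If \<open>p\<close> is least, the lower envelope bends only along \<open>x + y + z = 1\<close>, \<open>x + y + z = 2\<close>,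
  \<open>x + z = 1\<close> and \<open>x + y = 1\<close>. The first two planes cut off the corners at the origin and at
  \<open>(1, 1, 1)\<close>; the other two divide the octahedron in between into four tetrahedra around the
  diagonal from \<open>(1, 0, 0)\<close> to \<open>(0, 1, 1)\<close>. The weights below are the barycentric coordinates
  in these six simplices.
\<close>

lemma conv_env_in_convex_if_least:
  assumes C: "convex C"
    and V: "(0, 0, 0, 0) \<in> C" "(0, 1, 0, 0) \<in> C" "(0, 0, 1, 0) \<in> C" "(0, 0, 0, 1) \<in> C"
      "(p, 0, 1, 1) \<in> C" "(q, 1, 0, 1) \<in> C" "(r, 1, 1, 0) \<in> C" "(p + q + r + d, 1, 1, 1) \<in> C"
    and xyz: "x \<in> {0..1}" "y \<in> {0..1}" "z \<in> {0..1::real}"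
    and le: "p \<le> q" "p \<le> r"
  shows "(conv_env p q r d (x, y, z), x, y, z) \<in> C"
proof -
  have L: "conv_env p q r d (x, y, z) =
     p * (max 0 (x + y + z - 1) + max 0 (x + y + z - 2)) + d * max 0 (x + y + z - 2)
     + (q - p) * max 0 (x + z - 1) + (r - p) * max 0 (x + y - 1)"
    using le by (simp add: conv_env_def Let_def min_absorb1)
  note bary = convex_barycentric4[OF C]
  consider "x + y + z \<le> 1" | "2 \<le> x + y + z"
    | "1 \<le> x + y + z" "x + y + z \<le> 2" "x + y \<le> 1" "x + z \<le> 1"
    | "1 \<le> x + y + z" "x + y + z \<le> 2" "x + y \<le> 1" "1 \<le> x + z"
    | "1 \<le> x + y + z" "x + y + z \<le> 2" "1 \<le> x + y" "x + z \<le> 1"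
    | "1 \<le> x + y + z" "x + y + z \<le> 2" "1 \<le> x + y" "1 \<le> x + z" by linarith
  then show ?thesis
  proof cases
    case 1
    then show ?thesis
      using bary[OF V(1-4), of "1 - x - y - z" x y z] xyz by (auto simp: L algebra_simps)
  next
    case 2
    then show ?thesis
      using bary[OF V(8,5,6,7), of "x + y + z - 2" "1 - x" "1 - y" "1 - z"] xyz
      by (auto simp: L algebra_simps)
  next
    case 3
    then show ?thesis
      using bary[OF V(2,5,3,4), of x "x + y + z - 1" "1 - x - z" "1 - x - y"] xyz
      by (auto simp: L algebra_simps)
  next
    case 4
    then show ?thesis
      using bary[OF V(2,5,6,4), of "1 - z" y "x + z - 1" "1 - x - y"] xyz
      by (auto simp: L algebra_simps)
  next
    case 5
    then show ?thesis
      using bary[OF V(2,5,7,3), of "1 - y" z "x + y - 1" "1 - x - z"] xyz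
      by (auto simp: L algebra_simps)
  next
    case 6
    then show ?thesis
      using bary[OF V(2,5,6,7), of "2 - x - y - z" "1 - x" "x + z - 1" "x + y - 1"] xyz
      by (auto simp: L algebra_simps)
  qed
qed

text \<open>
  Exchanging two coordinates exchanges two of \<open>p\<close>, \<open>q\<close>, \<open>r\<close>, so the case in which \<open>p\<close> is least
  applies to the correspondingly permuted convex set.
\<close>

lemma conv_env_in_convex:
  assumes C: "convex C"
    and V: "(0, 0, 0, 0) \<in> C" "(0, 1, 0, 0) \<in> C" "(0, 0, 1, 0) \<in> C" "(0, 0, 0, 1) \<in> C"
      "(p, 0, 1, 1) \<in> C" "(q, 1, 0, 1) \<in> C" "(r, 1, 1, 0) \<in> C" "(p + q + r + d, 1, 1, 1) \<in> C"
    and xyz: "x \<in> {0..1}" "y \<in> {0..1}" "z \<in> {0..1::real}"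
  shows "(conv_env p q r d (x, y, z), x, y, z) \<in> C"
proof -
  consider "p \<le> q" "p \<le> r" | "q \<le> p" "q \<le> r" | "r \<le> q" "r \<le> p" by linarith
  then show ?thesis
  proof cases
    case 1
    then show ?thesis using conv_env_in_convex_if_least[OF C V xyz] by simp
  next
    case 2
    define f where "f = (\<lambda>(v::real, x::real, y::real, z::real). (v, y, x, z))"
    have "linear f" by (rule linearI) (auto simp: f_def)
    then have C': "convex (f -` C)" using C by (rule convex_linear_vimage)
    have V': "(q + p + r + d, 1, 1, 1) \<in> f -` C" using V(8) by (simp add: f_def add.commute)
    have "(conv_env q p r d (y, x, z), y, x, z) \<in> f -` C"
      by (rule conv_env_in_convex_if_least[OF C' _ _ _ _ _ _ _ V']) (use 2 V xyz in \<open>simp_all add: f_def\<close>)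
    moreover have "conv_env q p r d (y, x, z) = conv_env p q r d (x, y, z)"
    proof -
      have m: "min q (min p r) = min p (min q r)" by (rule min.left_commute)
      have s: "y + x + z = x + y + z" "y + x = x + y" by simp_all
      show ?thesis unfolding conv_env_def prod.case Let_def m s by simp
    qed
    ultimately show ?thesis by (simp add: f_def)
  next
    case 3
    define f where "f = (\<lambda>(v::real, x::real, y::real, z::real). (v, z, y, x))"
    have "linear f" by (rule linearI) (auto simp: f_def)
    then have C': "convex (f -` C)" using C by (rule convex_linear_vimage)
    have V': "(r + q + p + d, 1, 1, 1) \<in> f -` C" using V(8) by (simp add: f_def add.commute add.left_commute)
    have "(conv_env r q p d (z, y, x), z, y, x) \<in> f -` C"
      by (rule conv_env_in_convex_if_least[OF C' _ _ _ _ _ _ _ V']) (use 3 V xyz in \<open>simp_all add: f_def\<close>)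
    moreover have "conv_env r q p d (z, y, x) = conv_env p q r d (x, y, z)"
    proof -
      have m: "min r (min q p) = min p (min q r)" by (simp add: min.commute min.left_commute)
      have s: "z + y = y + z" "y + z + x = x + y + z" "y + x = x + y" "z + x = x + z" by simp_all
      show ?thesis unfolding conv_env_def prod.case Let_def m s by simp
    qed
    ultimately show ?thesis by (simp add: f_def)
  qed
qed

lemma concave_conc_env:
  assumes "0 \<le> p" "0 \<le> q" "0 \<le> r" "0 \<le> d"
  shows "concave_on UNIV (conc_env p q r d)"
proof -
  have min: "s * min a b + t * min a' b' \<le> min (s * a + t * a') (s * b + t * b')"
    if "0 \<le> s" "0 \<le> t" for s t a b a' b' :: real
    using that by (auto intro!: add_mono mult_left_mono)
  have min3: "s * min a (min b c) + t * min a' (min b' c') \<le> min (s * a + t * a') (min (s * b + t * b') (s * c + t * c'))"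
    if "0 \<le> s" "0 \<le> t" for s t a b c a' b' c' :: real
    using that by (auto intro!: add_mono mult_left_mono)
  show ?thesis
    unfolding concave_on_iff
  proof (clarsimp, goal_cases)
    case (1 x y z x' y' z' s t)
    show ?case
      using mult_left_mono[OF min[OF 1(1,2), of y z y' z'] assms(1)]
        mult_left_mono[OF min[OF 1(1,2), of x z x' z'] assms(2)]
        mult_left_mono[OF min[OF 1(1,2), of x y x' y'] assms(3)]
        mult_left_mono[OF min3[OF 1(1,2), of x y z x' y' z'] assms(4)]
      by (simp add: conc_env_def algebra_simps)
  qed
qed

lemma convex_conv_env:
  assumes "0 \<le> p" "0 \<le> q" "0 \<le> r" "0 \<le> d"
  shows "convex_on UNIV (conv_env p q r d)"
proof -
  define m where "m = min p (min q r)"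
  have m: "0 \<le> m" "0 \<le> p - m" "0 \<le> q - m" "0 \<le> r - m" using assms by (auto simp: m_def)
  have max: "max 0 (a - k) \<le> s * max 0 (b - k) + t * max 0 (c - k)"
    if "0 \<le> s" "0 \<le> t" "s + t = 1" "a = s * b + t * c" for s t a b c k :: real
  proof -
    have "a - k = s * b + t * c - (s + t) * k" using that by simp
    also have "\<dots> = s * (b - k) + t * (c - k)" by (simp add: algebra_simps)
    also have "\<dots> \<le> s * max 0 (b - k) + t * max 0 (c - k)"
      using that by (intro add_mono mult_left_mono) auto
    finally show ?thesis using that by simp
  qed
  show ?thesis
    unfolding convex_on_def
  proof (clarsimp, goal_cases)
    case (1 x y z x' y' z' s t)
    note mx = max[OF 1(1-3)]
    let ?X = "s * x + t * x'" and ?Y = "s * y + t * y'" and ?Z = "s * z + t * z'"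
    show ?case
      using mult_left_mono[OF mx[of "?X + ?Y + ?Z" "x + y + z" "x' + y' + z'" 1] m(1)]
        mult_left_mono[OF mx[of "?X + ?Y + ?Z" "x + y + z" "x' + y' + z'" 2] m(1)]
        mult_left_mono[OF mx[of "?X + ?Y + ?Z" "x + y + z" "x' + y' + z'" 2] assms(4)]
        mult_left_mono[OF mx[of "?Y + ?Z" "y + z" "y' + z'" 1] m(2)]
        mult_left_mono[OF mx[of "?X + ?Z" "x + z" "x' + z'" 1] m(3)]
        mult_left_mono[OF mx[of "?X + ?Y" "x + y" "x' + y'" 1] m(4)]
      by (simp add: conv_env_def flip: m_def) (simp add: algebra_simps)
  qed
qed

lemma prod_le_min: "x * y \<le> min x y" if "x \<in> {0..1}" "y \<in> {0..1}" for x y :: real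
  using that by (auto simp: mult_left_le mult_left_le_one_le)

lemma trilinear_le_conc_env:
  assumes "0 \<le> p" "0 \<le> q" "0 \<le> r" "0 \<le> d"
    and "x \<in> {0..1}" "y \<in> {0..1}" "z \<in> {0..1}"
  shows "trilinear p q r d (x, y, z) \<le> conc_env p q r d (x, y, z)"
proof -
  have "x * y * z \<le> min x (min y z)"
    using prod_le_min[of x "y * z"] prod_le_min[of y z] assms
    by (simp add: mult_le_one mult.assoc)
  then show ?thesis
    unfolding trilinear_def conc_env_def prod.case
    using assms by (intro add_mono mult_left_mono prod_le_min) auto
qed

lemma conv_env_le_trilinear:
  assumes "0 \<le> p" "0 \<le> q" "0 \<le> r" "0 \<le> d"
    and xyz: "x \<in> {0..1}" "y \<in> {0..1}" "z \<in> {0..1}"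
  shows "conv_env p q r d (x, y, z) \<le> trilinear p q r d (x, y, z)"
proof -
  define m where "m = min p (min q r)"
  have m: "0 \<le> m" "0 \<le> p - m" "0 \<le> q - m" "0 \<le> r - m" using assms by (auto simp: m_def)
  have pair: "max 0 (s + t - 1) \<le> s * t" if "s \<in> {0..1}" "t \<in> {0..1}" for s t :: real
  proof -
    have "0 \<le> (1 - s) * (1 - t)" using that by simp
    then show ?thesis using that by (simp add: algebra_simps)
  qed
  have p3: "max 0 (x + y + z - 2) \<le> x * y * z"
    using pair[of x y] pair[of "x * y" z] xyz by (auto simp: mult_le_one)
  \<comment> \<open>The first two expressions are \<open>y z + x z + x y - (s - 1)\<close> and \<open>y z + x z + x y - (2 s - 3)\<close>
    for \<open>s = x + y + z\<close>, and \<open>0\<close>, \<open>s - 1\<close>, \<open>2 s - 3\<close> are the three affine pieces of the bound.\<close>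
  have "0 \<le> (1 - x) * (1 - y) * (1 - z) + x * y * z"
    "0 \<le> (1 - x) * (1 - y) + (1 - x) * (1 - z) + (1 - y) * (1 - z)"
    "0 \<le> y * z + x * z + x * y" using xyz by auto
  then have e2: "max 0 (x + y + z - 1) + max 0 (x + y + z - 2) \<le> y * z + x * z + x * y"
    by (auto simp: algebra_simps max_def)
  show ?thesis
    using mult_left_mono[OF e2 m(1)] mult_left_mono[OF p3 assms(4)]
      mult_left_mono[OF pair[OF xyz(2,3)] m(2)] mult_left_mono[OF pair[OF xyz(1,3)] m(3)]
      mult_left_mono[OF pair[OF xyz(1,2)] m(4)]
    by (simp add: conv_env_def trilinear_def flip: m_def) (simp add: algebra_simps)
qed

text \<open>
  The right-hand side is convex and contains the graph. Conversely both of its boundary graphs lie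
  in the hull, since the two envelopes are interpolations of vertex values, and hence so do the
  vertical segments between them.
\<close>

theorem convex_hull_trilinear:
  assumes nn: "0 \<le> p" "0 \<le> q" "0 \<le> r" "0 \<le> d"
  shows "convex hull ((\<lambda>t. (trilinear p q r d t, t)) ` ({0..1} \<times> {0..1} \<times> {0..1}))
    = {(v, t). t \<in> {0..1} \<times> {0..1} \<times> {0..1} \<and> conv_env p q r d t \<le> v \<and> v \<le> conc_env p q r d t}"
    (is "convex hull ?G = ?H")
proof
  let ?B = "{0..1} \<times> {0..1} \<times> {0..1} :: (real \<times> real \<times> real) set"
  have B: "convex ?B" by (intro convex_Times) simp_all
  have "?H = {(v, t). t \<in> ?B \<and> conv_env p q r d t \<le> v} \<inter> {(v, t). t \<in> ?B \<and> v \<le> conc_env p q r d t}"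
    by auto
  moreover have "convex {(v, t). t \<in> ?B \<and> conv_env p q r d t \<le> v}"
  proof -
    have eq: "{(v, t). t \<in> ?B \<and> conv_env p q r d t \<le> v} = prod.swap -` epigraph ?B (conv_env p q r d)"
      by (auto simp: epigraph_def)
    have "convex_on ?B (conv_env p q r d)"
      using convex_conv_env[OF nn] B by (auto intro: convex_on_subset)
    moreover have "linear (prod.swap :: real \<times> (real \<times> real \<times> real) \<Rightarrow> _)"
      by (rule linearI) auto
    ultimately show ?thesis
      unfolding eq by (intro convex_linear_vimage convex_epigraphI)
  qed
  moreover have "convex {(v, t). t \<in> ?B \<and> v \<le> conc_env p q r d t}"
  proof -
    have eq: "{(v, t). t \<in> ?B \<and> v \<le> conc_env p q r d t}
       = (\<lambda>(v, t). (t, - v)) -` epigraph ?B (\<lambda>t. - conc_env p q r d t)"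
      by (auto simp: epigraph_def)
    have "convex_on ?B (\<lambda>t. - conc_env p q r d t)"
      using concave_conc_env[OF nn] B unfolding concave_on_def by (auto intro: convex_on_subset)
    moreover have "linear (\<lambda>(v :: real, t :: real \<times> real \<times> real). (t, - v))"
      by (rule linearI) auto
    ultimately show ?thesis
      unfolding eq by (intro convex_linear_vimage convex_epigraphI)
  qed
  ultimately have "convex ?H" by (simp only: convex_Int)
  moreover have "?G \<subseteq> ?H"
    using trilinear_le_conc_env[OF nn] conv_env_le_trilinear[OF nn] by auto
  ultimately show "convex hull ?G \<subseteq> ?H" by (rule hull_minimal[rotated])
next
  have V: "(trilinear p q r d t, t) \<in> convex hull ?G" if "t \<in> {0..1} \<times> {0..1} \<times> {0..1}" for t
    by (rule hull_inc) (use that in auto)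
  note vert = V[of "(0, 0, 0)"] V[of "(1, 0, 0)"] V[of "(0, 1, 0)"] V[of "(0, 0, 1)"]
    V[of "(0, 1, 1)"] V[of "(1, 0, 1)"] V[of "(1, 1, 0)"] V[of "(1, 1, 1)"]
  show "?H \<subseteq> convex hull ?G"
  proof clarify
    fix v x y z
    assume xyz: "x \<in> {0..1}" "y \<in> {0..1}" "z \<in> {0..1::real}"
      and v: "conv_env p q r d (x, y, z) \<le> v" "v \<le> conc_env p q r d (x, y, z)"
    let ?l = "conv_env p q r d (x, y, z)" and ?u = "conc_env p q r d (x, y, z)"
    have lu: "(?l, x, y, z) \<in> convex hull ?G" "(?u, x, y, z) \<in> convex hull ?G"
      using vert xyz by (auto simp: trilinear_def intro!: conv_env_in_convex conc_env_in_convex)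
    have "v \<in> closed_segment ?l ?u" using v by (simp add: closed_segment_eq_real_ivl)
    then obtain u where u: "0 \<le> u" "u \<le> 1" "v = (1 - u) * ?l + u * ?u"
      by (auto simp: closed_segment_def)
    have "(1 - u) *\<^sub>R (?l, x, y, z) + u *\<^sub>R (?u, x, y, z) \<in> convex hull ?G"
      by (rule convexD) (use u lu in auto)
    then show "(v, x, y, z) \<in> convex hull ?G" by (simp add: u(3) algebra_simps)
  qed
qed

section \<open>Integrals over the unit cube\<close>

lemma integral_box3:
  fixes f :: "real \<times> real \<times> real \<Rightarrow> real"
  assumes "continuous_on UNIV f"
  shows "integral (cbox (a1, a2, a3) (b1, b2, b3)) f =
    integral {a1..b1} (\<lambda>x. integral {a2..b2} (\<lambda>y. integral {a3..b3} (\<lambda>z. f (x, y, z))))"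
proof -
  have "integral (cbox (a1, a2, a3) (b1, b2, b3)) f =
      integral {a1..b1} (\<lambda>x. integral (cbox (a2, a3) (b2, b3)) (\<lambda>t. f (x, t)))"
    using integral_prod_continuous[of a1 "(a2, a3)" b1 "(b2, b3)" f] assms
    by (simp add: continuous_on_subset[OF assms])
  moreover have "continuous_on UNIV (\<lambda>t. f (x, t))" for x
    by (rule continuous_on_compose2[OF assms]) (auto intro!: continuous_intros)
  then have "integral (cbox (a2, a3) (b2, b3)) (\<lambda>t. f (x, t)) =
      integral {a2..b2} (\<lambda>y. integral {a3..b3} (\<lambda>z. f (x, y, z)))" for x
    using integral_prod_continuous[of a2 a3 b2 b3 "\<lambda>t. f (x, t)"]
    by (simp add: continuous_on_subset[of UNIV])
  ultimately show ?thesis by simp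
qed

lemma has_integral_unit_cube:
  fixes f :: "real \<times> real \<times> real \<Rightarrow> real"
  assumes f: "continuous_on UNIV f"
    and z: "\<And>x y. x \<in> {0..1} \<Longrightarrow> y \<in> {0..1} \<Longrightarrow> ((\<lambda>z. f (x, y, z)) has_integral g x y) {0..1}"
    and y: "\<And>x. x \<in> {0..1} \<Longrightarrow> ((\<lambda>y. g x y) has_integral h x) {0..1}"
    and x: "(h has_integral I) {0..1}"
  shows "(f has_integral I) (cbox (0, 0, 0) (1, 1, 1))"
proof -
  have "integral (cbox (0, 0, 0) (1, 1, 1)) f =
      integral {0..1} (\<lambda>x. integral {0..1} (\<lambda>y. integral {0..1} (\<lambda>z. f (x, y, z))))"
    by (rule integral_box3[OF f])
  also have "\<dots> = integral {0..1} (\<lambda>x. integral {0..1} (\<lambda>y. g x y))"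
    by (intro integral_cong integral_unique z) auto
  also have "\<dots> = integral {0..1} h"
    by (intro integral_cong integral_unique y) auto
  also have "\<dots> = I" by (rule integral_unique[OF x])
  finally show ?thesis
    using integrable_continuous[OF continuous_on_subset[OF f subset_UNIV]] by (metis integrable_integral)
qed

text \<open>
  All the functions to be integrated are combinations of truncated powers: the antiderivative of
  \<open>max 0 t ^ n\<close> is \<open>max 0 t ^ (n + 1) / (n + 1)\<close> without any distinction of cases.
\<close>

lemma has_integral_truncated_power:
  fixes c :: real
  assumes "0 < n"
  shows "((\<lambda>t. max 0 (t + c) ^ n) has_integral
    (max 0 (1 + c) ^ Suc n - max 0 c ^ Suc n) / Suc n) {0..1}"
proof -
  have "((\<lambda>t. max 0 (t + c) ^ n) has_integral max 0 (1 + c) ^ Suc n / Suc n - max 0 (0 + c) ^ Suc n / Suc n) {0..1}"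
  proof (rule fundamental_theorem_of_calculus_interior_strong[of "{- c}"])
    fix t assume "t \<in> {0<..<1} - {- c}"
    then consider "t < - c" | "- c < t" by force
    then show "((\<lambda>t. max 0 (t + c) ^ Suc n / Suc n) has_vector_derivative max 0 (t + c) ^ n) (at t)"
    proof cases
      case 1
      have "((\<lambda>t. 0) has_vector_derivative 0) (at t)" by simp
      then have "((\<lambda>t. max 0 (t + c) ^ Suc n / Suc n) has_vector_derivative 0) (at t)"
        by (rule has_vector_derivative_transform_within_open[where S = "{..<- c}"]) (use 1 in auto)
      moreover have eq: "max 0 (t + c) ^ n = 0" using 1 assms by simp
      ultimately show ?thesis unfolding eq by blast
    next
      case 2
      have "((\<lambda>t. (t + c) ^ Suc n / Suc n) has_vector_derivative (t + c) ^ n) (at t)"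
        unfolding has_real_derivative_iff_has_vector_derivative[symmetric]
        by (rule derivative_eq_intros refl | simp)+
      then have "((\<lambda>t. max 0 (t + c) ^ Suc n / Suc n) has_vector_derivative (t + c) ^ n) (at t)"
        by (rule has_vector_derivative_transform_within_open[where S = "{- c<..}"]) (use 2 in auto)
      moreover have eq: "max 0 (t + c) = t + c" using 2 by simp
      ultimately show ?thesis unfolding eq by blast
    qed
  qed (auto intro!: continuous_intros)
  then show ?thesis by (simp add: diff_divide_distrib)
qed

lemma has_integral_const_unit: "((\<lambda>t. c) has_integral c) {0..1::real}" for c :: real
  using has_integral_const_real[of c 0 1] by simp

lemma has_integral_power_unit:
  assumes "0 < n"
  shows "((\<lambda>t::real. t ^ n) has_integral 1 / Suc n) {0..1}"
  using has_integral_eq[OF _ has_integral_truncated_power[OF assms, of 0], of "\<lambda>t. t ^ n"] by simp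

lemma has_integral_min_unit:
  fixes c :: real
  assumes "c \<in> {0..1}"
  shows "((\<lambda>t. min c t) has_integral c - c\<^sup>2 / 2) {0..1}"
proof -
  have "((\<lambda>t. t ^ 1 - max 0 (t + - c) ^ 1) has_integral
      1 / Suc 1 - (max 0 (1 + - c) ^ Suc 1 - max 0 (- c) ^ Suc 1) / Suc 1) {0..1}"
    by (intro has_integral_diff has_integral_power_unit has_integral_truncated_power) auto
  \<comment> \<open>Writing the minimum with a positive part reduces it to truncated powers.\<close>
  moreover have "(\<lambda>t. t ^ 1 - max 0 (t + - c) ^ 1) = (\<lambda>t. min c t)" by auto
  ultimately show ?thesis using assms by (simp add: power2_eq_square field_simps)
qed

lemma has_integral_min_square_unit:
  fixes c :: real
  assumes "c \<in> {0..1}"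
  shows "((\<lambda>t. (min c t)\<^sup>2) has_integral c\<^sup>2 - 2 * c ^ 3 / 3) {0..1}"
proof -
  have "((\<lambda>t. t ^ 2 - max 0 (t + - c) ^ 2 - 2 * c * max 0 (t + - c) ^ 1) has_integral
      1 / Suc 2 - (max 0 (1 + - c) ^ Suc 2 - max 0 (- c) ^ Suc 2) / Suc 2
      - 2 * c * ((max 0 (1 + - c) ^ Suc 1 - max 0 (- c) ^ Suc 1) / Suc 1)) {0..1}"
    by (intro has_integral_diff has_integral_power_unit has_integral_truncated_power has_integral_mult_right) auto
  moreover have "(\<lambda>t. t ^ 2 - max 0 (t + - c) ^ 2 - 2 * c * max 0 (t + - c) ^ 1) = (\<lambda>t. (min c t)\<^sup>2)"
    by (auto simp: fun_eq_iff min_def max_def power2_eq_square algebra_simps)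
  moreover have "1 / Suc 2 - (max 0 (1 + - c) ^ Suc 2 - max 0 (- c) ^ Suc 2) / Suc 2
      - 2 * c * ((max 0 (1 + - c) ^ Suc 1 - max 0 (- c) ^ Suc 1) / Suc 1) = c\<^sup>2 - 2 * c ^ 3 / 3"
  proof -
    have "max 0 (1 + - c) = 1 - c" "max 0 (- c) = 0" using assms by auto
    then show ?thesis by (simp add: power2_eq_square power3_eq_cube field_simps)
  qed
  ultimately show ?thesis by (simp only:)
qed

lemma has_integral_unit_cube_min:
  "((\<lambda>(x::real, y::real, z::real). min y z) has_integral 1 / 3) (cbox (0, 0, 0) (1, 1, 1))"
  "((\<lambda>(x::real, y::real, z::real). min x z) has_integral 1 / 3) (cbox (0, 0, 0) (1, 1, 1))"
  "((\<lambda>(x::real, y::real, z::real). min x y) has_integral 1 / 3) (cbox (0, 0, 0) (1, 1, 1))"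
proof -
  have *: "((\<lambda>t. t - t\<^sup>2 / 2) has_integral 1 / 3) {0..1::real}"
    using has_integral_diff[OF has_integral_power_unit[of 1] has_integral_divide[OF has_integral_power_unit[of 2], of 2]]
    by simp
  show "((\<lambda>(x::real, y::real, z::real). min y z) has_integral 1 / 3) (cbox (0, 0, 0) (1, 1, 1))"
    by (rule has_integral_unit_cube[where g = "\<lambda>x y. y - y\<^sup>2 / 2" and h = "\<lambda>x. 1 / 3"])
      (use * has_integral_min_unit has_integral_const_unit in
        \<open>auto simp: case_prod_beta intro!: continuous_intros\<close>)
  show "((\<lambda>(x::real, y::real, z::real). min x z) has_integral 1 / 3) (cbox (0, 0, 0) (1, 1, 1))"
    by (rule has_integral_unit_cube[where g = "\<lambda>x y. x - x\<^sup>2 / 2" and h = "\<lambda>x. x - x\<^sup>2 / 2"])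
      (use * has_integral_min_unit has_integral_const_unit in
        \<open>auto simp: case_prod_beta intro!: continuous_intros\<close>)
  show "((\<lambda>(x::real, y::real, z::real). min x y) has_integral 1 / 3) (cbox (0, 0, 0) (1, 1, 1))"
    by (rule has_integral_unit_cube[where g = "\<lambda>x y. min x y" and h = "\<lambda>x. x - x\<^sup>2 / 2"])
      (use * has_integral_min_unit has_integral_const_unit in
        \<open>auto simp: case_prod_beta intro!: continuous_intros\<close>)
qed

lemma has_integral_unit_cube_min3:
  "((\<lambda>(x::real, y::real, z::real). min x (min y z)) has_integral 1 / 4) (cbox (0, 0, 0) (1, 1, 1))"
proof (rule has_integral_unit_cube[where g = "\<lambda>x y. min x y - (min x y)\<^sup>2 / 2"
      and h = "\<lambda>x. (x - x\<^sup>2 / 2) - (x\<^sup>2 - 2 * x ^ 3 / 3) / 2"])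
  show "continuous_on UNIV (\<lambda>(x::real, y::real, z::real). min x (min y z) :: real)"
    by (auto simp: case_prod_beta intro!: continuous_intros)
  show "((\<lambda>z. case (x, y, z) of (x, y, z) \<Rightarrow> min x (min y z)) has_integral
      min x y - (min x y)\<^sup>2 / 2) {0..1}" if "x \<in> {0..1}" "y \<in> {0..1}" for x y :: real
    using has_integral_min_unit[of "min x y"] that by (simp add: min.assoc min_le_iff_disj)
  show "((\<lambda>y. min x y - (min x y)\<^sup>2 / 2) has_integral (x - x\<^sup>2 / 2) - (x\<^sup>2 - 2 * x ^ 3 / 3) / 2) {0..1}"
    if "x \<in> {0..1}" for x :: real
    by (intro has_integral_diff has_integral_divide has_integral_min_unit has_integral_min_square_unit that)
  have "((\<lambda>x::real. (x ^ 1 - x\<^sup>2 / 2) - (x\<^sup>2 - 2 * x ^ 3 / 3) / 2) has_integral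
      (1 / Suc 1 - 1 / Suc 2 / 2) - (1 / Suc 2 - 2 * (1 / Suc 3) / 3) / 2) {0..1}"
    by (intro has_integral_diff has_integral_divide has_integral_mult_right has_integral_power_unit) auto
  then show "((\<lambda>x::real. (x - x\<^sup>2 / 2) - (x\<^sup>2 - 2 * x ^ 3 / 3) / 2) has_integral 1 / 4) {0..1}"
    by simp
qed

lemma has_integral_pos_part:
  fixes c :: real
  shows "((\<lambda>t. max 0 (t + c)) has_integral (max 0 (1 + c) ^ 2 - max 0 c ^ 2) / 2) {0..1}"
  using has_integral_truncated_power[of 1 c] by (simp add: numeral_2_eq_2)

lemma has_integral_unit_cube_max:
  "((\<lambda>(x::real, y::real, z::real). max 0 (y + z - 1)) has_integral 1 / 6) (cbox (0, 0, 0) (1, 1, 1))"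
  "((\<lambda>(x::real, y::real, z::real). max 0 (x + z - 1)) has_integral 1 / 6) (cbox (0, 0, 0) (1, 1, 1))"
  "((\<lambda>(x::real, y::real, z::real). max 0 (x + y - 1)) has_integral 1 / 6) (cbox (0, 0, 0) (1, 1, 1))"
proof -
  have sq: "((\<lambda>t. t\<^sup>2 / 2) has_integral 1 / 6) {0..1::real}"
    using has_integral_divide[OF has_integral_power_unit[of 2], of 2] by simp
  have pp: "((\<lambda>t. max 0 (s + t - 1)) has_integral s\<^sup>2 / 2) {0..1}" if "s \<in> {0..1}" for s :: real
    using has_integral_pos_part[of "s - 1"] that by (simp add: algebra_simps)
  show "((\<lambda>(x::real, y::real, z::real). max 0 (y + z - 1)) has_integral 1 / 6) (cbox (0, 0, 0) (1, 1, 1))"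
    by (rule has_integral_unit_cube[where g = "\<lambda>x y. y\<^sup>2 / 2" and h = "\<lambda>x. 1 / 6"])
      (use sq pp has_integral_const_unit in
        \<open>auto simp: case_prod_beta intro!: continuous_intros\<close>)
  show "((\<lambda>(x::real, y::real, z::real). max 0 (x + z - 1)) has_integral 1 / 6) (cbox (0, 0, 0) (1, 1, 1))"
    by (rule has_integral_unit_cube[where g = "\<lambda>x y. x\<^sup>2 / 2" and h = "\<lambda>x. x\<^sup>2 / 2"])
      (use sq pp has_integral_const_unit in
        \<open>auto simp: case_prod_beta intro!: continuous_intros\<close>)
  show "((\<lambda>(x::real, y::real, z::real). max 0 (x + y - 1)) has_integral 1 / 6) (cbox (0, 0, 0) (1, 1, 1))"
    by (rule has_integral_unit_cube[where g = "\<lambda>x y. max 0 (x + y - 1)" and h = "\<lambda>x. x\<^sup>2 / 2"])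
      (use sq pp has_integral_const_unit in
        \<open>auto simp: case_prod_beta intro!: continuous_intros\<close>)
qed

text \<open>
  Each integration of a truncated power over a unit interval raises the exponent by one and takes
  a difference in the shift, so three of them give a third difference of fourth powers.
\<close>

lemma has_integral_unit_cube_max3:
  fixes k :: real
  shows "((\<lambda>(x, y, z). max 0 (x + y + z - k)) has_integral
    (max 0 (3 - k) ^ 4 - 3 * max 0 (2 - k) ^ 4 + 3 * max 0 (1 - k) ^ 4 - max 0 (- k) ^ 4) / 24)
    (cbox (0, 0, 0) (1, 1, 1))"
proof -
  have pow: "((\<lambda>t. max 0 (t + c) ^ n) has_integral (max 0 c' ^ m - max 0 c ^ m) / m) {0..1}"
    if "0 < n" "m = Suc n" "c' = c + 1" for c c' :: real and n m :: nat
    using has_integral_truncated_power[OF that(1), of c] by (simp only: that(2,3) add.commute)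
  show ?thesis
  proof (rule has_integral_unit_cube)
    show "continuous_on UNIV (\<lambda>(x, y, z). max 0 (x + y + z - k))"
      by (auto simp: case_prod_beta intro!: continuous_intros)
    show "((\<lambda>z. case (x, y, z) of (x, y, z) \<Rightarrow> max 0 (x + y + z - k)) has_integral
        (max 0 (y + (x + (1 - k))) ^ 2 - max 0 (y + (x + - k)) ^ 2) / 2) {0..1}" for x y :: real
    proof -
      have "(\<lambda>z. case (x, y, z) of (x, y, z) \<Rightarrow> max 0 (x + y + z - k)) = (\<lambda>z. max 0 (z + (y + (x + - k))) ^ 1)"
        by (simp add: algebra_simps)
      then show ?thesis using pow[of 1 2 "y + (x + (1 - k))" "y + (x + - k)"] by simp
    qed
    show "((\<lambda>y. (max 0 (y + (x + (1 - k))) ^ 2 - max 0 (y + (x + - k)) ^ 2) / 2) has_integral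
        ((max 0 (x + (2 - k)) ^ 3 - max 0 (x + (1 - k)) ^ 3) / real 3
         - (max 0 (x + (1 - k)) ^ 3 - max 0 (x + - k) ^ 3) / real 3) / 2) {0..1}" for x :: real
      by (intro has_integral_divide has_integral_diff pow) auto
    have "((\<lambda>x. ((max 0 (x + (2 - k)) ^ 3 - max 0 (x + (1 - k)) ^ 3) / real 3
         - (max 0 (x + (1 - k)) ^ 3 - max 0 (x + - k) ^ 3) / real 3) / 2) has_integral
       ((((max 0 (3 - k) ^ 4 - max 0 (2 - k) ^ 4) / real 4
         - (max 0 (2 - k) ^ 4 - max 0 (1 - k) ^ 4) / real 4) / real 3
       - ((max 0 (2 - k) ^ 4 - max 0 (1 - k) ^ 4) / real 4
         - (max 0 (1 - k) ^ 4 - max 0 (- k) ^ 4) / real 4) / real 3) / 2)) {0..1}"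
      by (intro has_integral_divide has_integral_diff pow) auto
    then show "((\<lambda>x. ((max 0 (x + (2 - k)) ^ 3 - max 0 (x + (1 - k)) ^ 3) / real 3
         - (max 0 (x + (1 - k)) ^ 3 - max 0 (x + - k) ^ 3) / real 3) / 2) has_integral
       (max 0 (3 - k) ^ 4 - 3 * max 0 (2 - k) ^ 4 + 3 * max 0 (1 - k) ^ 4 - max 0 (- k) ^ 4) / 24) {0..1}"
      by (rule has_integral_eq_rhs) (simp add: field_simps)
  qed
qed

lemma has_integral_envelope_gap:
  "((\<lambda>t. conc_env p q r d t - conv_env p q r d t) has_integral
    (5 * d + 4 * (p + q + r) - 2 * min p (min q r)) / 24) (cbox (0, 0, 0) (1, 1, 1))"
proof -
  define m where "m = min p (min q r)"
  let ?C = "cbox (0, 0, 0) (1, 1, 1)"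
  have s1: "((\<lambda>(x::real, y::real, z::real). max 0 (x + y + z - 1)) has_integral 13 / 24) ?C"
    using has_integral_unit_cube_max3[of 1] by simp
  have s2: "((\<lambda>(x::real, y::real, z::real). max 0 (x + y + z - 2)) has_integral 1 / 24) ?C"
    using has_integral_unit_cube_max3[of 2] by simp
  note ints = has_integral_unit_cube_min has_integral_unit_cube_min3 has_integral_unit_cube_max s1 s2
  have conc: "(conc_env p q r d has_integral p * (1 / 3) + q * (1 / 3) + r * (1 / 3) + d * (1 / 4)) ?C"
    using ints unfolding conc_env_def case_prod_beta
    by (intro has_integral_add has_integral_mult_right) auto
  have conv: "(conv_env p q r d has_integral m * (13 / 24 + 1 / 24) + d * (1 / 24)
     + (p - m) * (1 / 6) + (q - m) * (1 / 6) + (r - m) * (1 / 6)) ?C"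
    using ints unfolding conv_env_def case_prod_beta Let_def m_def[symmetric]
    by (intro has_integral_add has_integral_mult_right) auto
  show ?thesis
    by (rule has_integral_eq_rhs[OF has_integral_diff[OF conc conv]])
      (simp add: m_def[symmetric] field_simps)
qed

section \<open>The volume of the relaxation\<close>

text \<open>
  Cavalieri's principle in the vertical direction.
\<close>

lemma measure_between_graphs:
  fixes l u :: "'a::euclidean_space \<Rightarrow> real"
  assumes K: "compact K" and cont: "continuous_on K l" "continuous_on K u"
    and le: "\<And>x. x \<in> K \<Longrightarrow> l x \<le> u x"
    and I: "((\<lambda>x. u x - l x) has_integral I) K"
  shows "measure lebesgue {(v, x). x \<in> K \<and> l x \<le> v \<and> v \<le> u x} = I"
proof -
  let ?S = "{(v, x). x \<in> K \<and> l x \<le> v \<and> v \<le> u x}"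
  \<comment> \<open>Measurability: the region is a continuous image of a compact cylinder.\<close>
  have "?S = (\<lambda>(s, x). (l x + s * (u x - l x), x)) ` ({0..1} \<times> K)"
  proof safe
    fix v x assume *: "x \<in> K" "l x \<le> v" "v \<le> u x"
    have "v \<in> closed_segment (l x) (u x)" using * by (simp add: closed_segment_eq_real_ivl)
    then obtain s where s: "0 \<le> s" "s \<le> 1" "v = (1 - s) * l x + s * u x"
      by (auto simp: closed_segment_def)
    then have "v = l x + s * (u x - l x)" by (simp add: algebra_simps)
    then show "(v, x) \<in> (\<lambda>(s, x). (l x + s * (u x - l x), x)) ` ({0..1} \<times> K)"
      using s * by force
  next
    fix s x assume "x \<in> K" "s \<in> {0..1::real}"
    then show "l x \<le> l x + s * (u x - l x)" "l x + s * (u x - l x) \<le> u x"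
      using le[of x] mult_right_mono[of s 1 "u x - l x"] by auto
  qed
  moreover have cont': "continuous_on ({0..1::real} \<times> K) (\<lambda>p. l (snd p))"
      "continuous_on ({0..1::real} \<times> K) (\<lambda>p. u (snd p))"
    by (rule continuous_on_compose2[OF cont(1)] continuous_on_compose2[OF cont(2)];
        auto intro: continuous_on_snd continuous_on_id)+
  then have "compact ((\<lambda>(s, x). (l x + s * (u x - l x), x)) ` ({0..1::real} \<times> K))"
    unfolding case_prod_beta
    by (intro compact_continuous_image compact_Times compact_Icc K continuous_intros cont')
  ultimately have "compact ?S" by simp
  then have S: "?S \<in> sets borel" by (simp add: borel_compact)
  have "emeasure lebesgue ?S = emeasure (lborel \<Otimes>\<^sub>M lborel) ?S"
    using S by (simp add: lborel_prod)
  also have "\<dots> = (\<integral>\<^sup>+ x. emeasure lborel ((\<lambda>v. (v, x)) -` ?S) \<partial>lborel)"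
    by (intro lborel_pair.emeasure_pair_measure_alt2, unfold lborel_prod) (use S in simp)
  also have "\<dots> = (\<integral>\<^sup>+ x. ennreal (u x - l x) * indicator K x \<partial>lborel)"
  proof (rule nn_integral_cong)
    fix x
    have "(\<lambda>v. (v, x)) -` ?S = (if x \<in> K then {l x..u x} else {})" by auto
    then show "emeasure lborel ((\<lambda>v. (v, x)) -` ?S) = ennreal (u x - l x) * indicator K x"
      using le by simp
  qed
  also have "\<dots> = ennreal I"
    using le I by (intro nn_integral_has_integral_lebesgue') auto
  finally have "emeasure lebesgue ?S = ennreal I" .
  moreover have "0 \<le> I" using I le by (intro has_integral_nonneg[OF I]) auto
  ultimately show ?thesis by (simp add: measure_eq_emeasure_eq_ennreal)
qed

lemma integral_rescale_unit_interval:
  fixes f :: "real \<Rightarrow> real"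
  assumes "0 < d"
  shows "integral {a..a + d} (\<lambda>x. f ((x - a) / d)) = d * integral {0..1} f"
proof -
  have *: "((\<lambda>x. f ((x - a) / d)) has_integral d * i) {a..a + d}" if "(f has_integral i) {0..1}" for i
  proof -
    have "((\<lambda>x. f ((1 / d) *\<^sub>R x + - (a / d))) has_integral i /\<^sub>R (1 / d) ^ DIM(real))
        (cbox ((0 - - (a / d)) /\<^sub>R (1 / d)) ((1 - - (a / d)) /\<^sub>R (1 / d)))"
      using assms that by (intro has_integral_affinity') auto
    moreover have "(1 / d) *\<^sub>R x + - (a / d) = (x - a) / d" for x
      by (simp add: diff_divide_distrib)
    moreover have "(0 - - (a / d)) /\<^sub>R (1 / d) = a"
      using assms by (simp)
    moreover have "(1 - - (a / d)) /\<^sub>R (1 / d) = a + d"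
      using assms by (simp add: distrib_left)
    moreover have      "i /\<^sub>R (1 / d) ^ DIM(real) = d * i"
      using assms by (simp)
    ultimately show ?thesis by (simp only: box_real)
  qed
  have **: "(f has_integral i / d) {0..1}" if "((\<lambda>x. f ((x - a) / d)) has_integral i) {a..a + d}" for i
  proof -
    have "((\<lambda>x. f ((d *\<^sub>R x + a - a) / d)) has_integral (i /\<^sub>R d ^ DIM(real))) (cbox ((a - a) /\<^sub>R d) ((a + d - a) /\<^sub>R d))"
      using assms that by (intro has_integral_affinity'[of "\<lambda>x. f ((x - a) / d)" i a "a + d" d a]) auto
    moreover have "(d *\<^sub>R x + a - a) / d = x" for x using assms by simp
    moreover have "i /\<^sub>R d ^ DIM(real) = i / d" by (simp add: divide_inverse_commute)
    moreover have "(a - a) /\<^sub>R d = 0" "(a + d - a) /\<^sub>R d = 1" using assms by simp_all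
    ultimately show ?thesis by (simp only: box_real)
  qed
  show ?thesis
  proof (cases "f integrable_on {0..1}")
    case True
    then show ?thesis by (intro integral_unique * integrable_integral)
  next
    case False
    then have "\<not> (\<lambda>x. f ((x - a) / d)) integrable_on {a..a + d}"
      using ** by (auto simp: integrable_on_def)
    with False show ?thesis by (simp add: not_integrable_integral)
  qed
qed

lemma integral_rescale_unit_cube:
  fixes f :: "real \<times> real \<times> real \<Rightarrow> real"
  assumes f: "continuous_on UNIV f" and d: "0 < d1" "0 < d2" "0 < d3"
  shows "integral (cbox (a1, a2, a3) (a1 + d1, a2 + d2, a3 + d3))
      (\<lambda>(x, y, z). f ((x - a1) / d1, (y - a2) / d2, (z - a3) / d3)) =
    d1 * d2 * d3 * integral (cbox (0, 0, 0) (1, 1, 1)) f"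
proof -
  have "continuous_on UNIV (\<lambda>(x, y, z). f ((x - a1) / d1, (y - a2) / d2, (z - a3) / d3))"
    unfolding case_prod_beta
    by (rule continuous_on_compose2[OF f]) (use d in \<open>auto intro!: continuous_intros\<close>)
  then have "integral (cbox (a1, a2, a3) (a1 + d1, a2 + d2, a3 + d3))
      (\<lambda>(x, y, z). f ((x - a1) / d1, (y - a2) / d2, (z - a3) / d3)) =
    integral {a1..a1 + d1} (\<lambda>x. integral {a2..a2 + d2} (\<lambda>y. integral {a3..a3 + d3}
      (\<lambda>z. f ((x - a1) / d1, (y - a2) / d2, (z - a3) / d3))))"
    by (subst integral_box3) (assumption, unfold prod.case, rule refl)
  also have "\<dots> = d1 * (d2 * (d3 * integral {0..1} (\<lambda>x. integral {0..1} (\<lambda>y. integral {0..1} (\<lambda>z. f (x, y, z))))))"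
  proof -
    have 3: "integral {a3..a3 + d3} (\<lambda>z. f (x, y, (z - a3) / d3)) = d3 * integral {0..1} (\<lambda>z. f (x, y, z))" for x y
      by (rule integral_rescale_unit_interval[OF d(3)])
    have 2: "integral {a2..a2 + d2} (\<lambda>y. integral {0..1} (\<lambda>z. f (x, (y - a2) / d2, z))) =
        d2 * integral {0..1} (\<lambda>y. integral {0..1} (\<lambda>z. f (x, y, z)))" for x
      by (rule integral_rescale_unit_interval[OF d(2)])
    have 1: "integral {a1..a1 + d1} (\<lambda>x. integral {0..1} (\<lambda>y. integral {0..1} (\<lambda>z. f ((x - a1) / d1, y, z)))) =
        d1 * integral {0..1} (\<lambda>x. integral {0..1} (\<lambda>y. integral {0..1} (\<lambda>z. f (x, y, z))))"
      by (rule integral_rescale_unit_interval[OF d(1)])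
    show ?thesis unfolding 3 integral_mult_right 2 1 by (simp only: ac_simps)
  qed
  also have "\<dots> = d1 * d2 * d3 * integral (cbox (0, 0, 0) (1, 1, 1)) f"
    unfolding integral_box3[OF f] by simp
  finally show ?thesis .
qed

text \<open>
  Substituting \<open>x\<^sub>i = a\<^sub>i + d\<^sub>i * t\<^sub>i\<close> turns the monomial into the affine function \<open>A\<close> of \<open>t\<close> plus a
  trilinear form. The map \<open>(v, t) \<mapsto> (v + A t, a + d t)\<close> is affine, so it commutes with taking
  convex hulls and carries the hull over the unit cube to the relaxation.
\<close>

theorem P_h_between_envelopes:
  fixes a1 a2 a3 d1 d2 d3 :: real
  assumes a: "0 \<le> a1" "0 \<le> a2" "0 \<le> a3" and d: "0 < d1" "0 < d2" "0 < d3"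
  defines "p \<equiv> a1 * d2 * d3" and "q \<equiv> d1 * a2 * d3" and "r \<equiv> d1 * d2 * a3" and "d \<equiv> d1 * d2 * d3"
    and "T \<equiv> \<lambda>(x, y, z). ((x - a1) / d1, (y - a2) / d2, (z - a3) / d3)"
    and "A \<equiv> \<lambda>(x, y, z). a1 * a2 * a3 + d1 * a2 * a3 * x + a1 * d2 * a3 * y + a1 * a2 * d3 * z"
  shows "P_h ({a1..a1 + d1} \<times> {a2..a2 + d2} \<times> {a3..a3 + d3}) =
    {(v, x). x \<in> {a1..a1 + d1} \<times> {a2..a2 + d2} \<times> {a3..a3 + d3} \<and>
      A (T x) + conv_env p q r d (T x) \<le> v \<and> v \<le> A (T x) + conc_env p q r d (T x)}"
proof -
  let ?B = "{a1..a1 + d1} \<times> {a2..a2 + d2} \<times> {a3..a3 + d3}"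
  let ?C = "{0..1} \<times> {0..1} \<times> {0..1} :: (real \<times> real \<times> real) set"
  define L where "L = (\<lambda>(v, x, y, z). (v + d1 * a2 * a3 * x + a1 * d2 * a3 * y + a1 * a2 * d3 * z,
    d1 * x, d2 * y, d3 * z))"
  define S where "S = (\<lambda>w. (a1 * a2 * a3, a1, a2, a3) + L w)"
  have S: "S (v, x, y, z) = (v + A (x, y, z), a1 + d1 * x, a2 + d2 * y, a3 + d3 * z)" for v x y z
    by (simp add: S_def L_def A_def)
  have "linear L" by (rule linearI) (auto simp: L_def algebra_simps)
  then have hull: "S ` (convex hull X) = convex hull (S ` X)" for X
    by (simp add: S_def convex_hull_linear_image convex_hull_translation flip: image_image)
  have T: "T x \<in> ?C \<longleftrightarrow> x \<in> ?B" for x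
    using d by (cases x) (auto simp: T_def field_simps)
  have ST: "S (v - A (T x), T x) = (v, x)" for v x
    using d by (cases x) (simp add: T_def S)
  have TS: "fst (S (v, t)) = v + A t" "T (snd (S (v, t))) = t" for v t
    using d by (cases t; simp add: T_def S)+
  have S_image: "S ` {(v, t). t \<in> ?C \<and> Q (v, t)} = {(v, x). x \<in> ?B \<and> Q (v - A (T x), T x)}" for Q
  proof (intro set_eqI iffI)
    fix w assume "w \<in> S ` {(v, t). t \<in> ?C \<and> Q (v, t)}"
    then obtain v t where vt: "t \<in> ?C" "Q (v, t)" "w = S (v, t)" by auto
    then have "fst w = v + A t" "T (snd w) = t" using TS by auto
    then show "w \<in> {(v, x). x \<in> ?B \<and> Q (v - A (T x), T x)}"
      using vt T[of "snd w"] by (simp add: case_prod_beta)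
  next
    fix w assume "w \<in> {(v, x). x \<in> ?B \<and> Q (v - A (T x), T x)}"
    then obtain v x where vx: "x \<in> ?B" "Q (v - A (T x), T x)" "w = (v, x)" by blast
    then have "(v - A (T x), T x) \<in> {(v, t). t \<in> ?C \<and> Q (v, t)}" using T[of x] by simp
    then have "S (v - A (T x), T x) \<in> S ` {(v, t). t \<in> ?C \<and> Q (v, t)}" by (rule imageI)
    then show "w \<in> S ` {(v, t). t \<in> ?C \<and> Q (v, t)}" by (simp only: ST vx(3))
  qed
  have "{(f, x, y, z). f = x * y * z \<and> (x, y, z) \<in> ?B}
    = {(v, x). x \<in> ?B \<and> v - A (T x) = trilinear p q r d (T x)}"
  proof -
    have tri: "A (T (x, y, z)) + trilinear p q r d (T (x, y, z)) = x * y * z" for x y z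
    proof -
      obtain s t u where "T (x, y, z) = (s, t, u)" by (metis surj_pair)
      moreover from this have "x = a1 + d1 * s" "y = a2 + d2 * t" "z = a3 + d3 * u"
        using d by (auto simp: T_def)
      ultimately show ?thesis
        by (simp add: A_def trilinear_def p_def q_def r_def d_def algebra_simps)
    qed
    have "v - A (T (x, y, z)) = trilinear p q r d (T (x, y, z)) \<longleftrightarrow> v = x * y * z" for v x y z
      using tri[of x y z] by linarith
    then show ?thesis by auto
  qed
  also have "\<dots> = S ` {(v, t). t \<in> ?C \<and> v = trilinear p q r d t}"
    using S_image[of "\<lambda>(v, t). v = trilinear p q r d t"] by simp
  also have "{(v, t). t \<in> ?C \<and> v = trilinear p q r d t} = (\<lambda>t. (trilinear p q r d t, t)) ` ?C"
    by blast
  finally have "P_h ?B = S ` (convex hull ((\<lambda>t. (trilinear p q r d t, t)) ` ?C))"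
    unfolding P_h_def hull by simp
  also have "\<dots> = S ` {(v, t). t \<in> ?C \<and> conv_env p q r d t \<le> v \<and> v \<le> conc_env p q r d t}"
    using a d by (subst convex_hull_trilinear) (auto simp: p_def q_def r_def d_def)
  also have "\<dots> = {(v, x). x \<in> ?B \<and> conv_env p q r d (T x) \<le> v - A (T x) \<and> v - A (T x) \<le> conc_env p q r d (T x)}"
    using S_image[of "\<lambda>(v, t). conv_env p q r d t \<le> v \<and> v \<le> conc_env p q r d t"] by simp
  finally show ?thesis by (simp add: algebra_simps)
qed

text \<open>
  The minimum distinguishes the variable with the smallest ratio \<open>a\<^sub>i / b\<^sub>i\<close>: dividing \<open>p\<close>, \<open>q\<close>, \<open>r\<close> by
  \<open>d\<close> leaves \<open>a\<^sub>i / (b\<^sub>i - a\<^sub>i)\<close>, which increases with that ratio. In this symmetric form the formula applies to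
  both children of a branching, in which the ratios can be ordered differently.
\<close>

theorem measure_P_h_box:
  fixes a1 a2 a3 b1 b2 b3 :: real
  assumes a: "0 \<le> a1" "0 \<le> a2" "0 \<le> a3" and b: "a1 \<le> b1" "a2 \<le> b2" "a3 \<le> b3"
  defines "p \<equiv> a1 * (b2 - a2) * (b3 - a3)" and "q \<equiv> (b1 - a1) * a2 * (b3 - a3)"
    and "r \<equiv> (b1 - a1) * (b2 - a2) * a3" and "d \<equiv> (b1 - a1) * (b2 - a2) * (b3 - a3)"
  shows "measure lebesgue (P_h ({a1..b1} \<times> {a2..b2} \<times> {a3..b3})) =
    d * (5 * d + 4 * (p + q + r) - 2 * min p (min q r)) / 24"
proof (cases "a1 < b1 \<and> a2 < b2 \<and> a3 < b3")
  case True
  define d1 d2 d3 where "d1 = b1 - a1" and "d2 = b2 - a2" and "d3 = b3 - a3"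
  have dpos: "0 < d1" "0 < d2" "0 < d3" using True by (auto simp: d1_def d2_def d3_def)
  have bs: "b1 = a1 + d1" "b2 = a2 + d2" "b3 = a3 + d3" by (auto simp: d1_def d2_def d3_def)
  have ps: "p = a1 * d2 * d3" "q = d1 * a2 * d3" "r = d1 * d2 * a3" "d = d1 * d2 * d3"
    by (auto simp: p_def q_def r_def d_def d1_def d2_def d3_def)
  have nn: "0 \<le> p" "0 \<le> q" "0 \<le> r" "0 \<le> d" using a dpos by (auto simp: ps)
  define T where "T = (\<lambda>(x, y, z). ((x - a1) / d1, (y - a2) / d2, (z - a3) / d3))"
  define A where "A = (\<lambda>(x, y, z). a1 * a2 * a3 + d1 * a2 * a3 * x + a1 * d2 * a3 * y + a1 * a2 * d3 * z)"
  let ?K = "cbox (a1, a2, a3) (a1 + d1, a2 + d2, a3 + d3)"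
  have K: "{a1..a1 + d1} \<times> {a2..a2 + d2} \<times> {a3..a3 + d3} = ?K"
    by (simp add: cbox_Pair_eq)
  have contT: "continuous_on X T" for X
    using dpos unfolding T_def case_prod_beta by (auto intro!: continuous_intros)
  have cont: "continuous_on X A" "continuous_on X (conv_env p q r d)" "continuous_on X (conc_env p q r d)" for X
    unfolding A_def conv_env_def conc_env_def case_prod_beta Let_def by (auto intro!: continuous_intros)
  have contT': "continuous_on X (\<lambda>x. A (T x))" "continuous_on X (\<lambda>x. conv_env p q r d (T x))"
    "continuous_on X (\<lambda>x. conc_env p q r d (T x))" for X
    by (rule continuous_on_compose2[OF cont(1) contT subset_UNIV]
        continuous_on_compose2[OF cont(2) contT subset_UNIV]
        continuous_on_compose2[OF cont(3) contT subset_UNIV])+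
  have le: "conv_env p q r d (T x) \<le> conc_env p q r d (T x)" if "x \<in> ?K" for x
  proof -
    obtain s t u where stu: "T x = (s, t, u)" by (metis surj_pair)
    then have "s \<in> {0..1}" "t \<in> {0..1}" "u \<in> {0..1}"
      using that dpos by (auto simp: T_def K[symmetric])
    then show ?thesis
      using conv_env_le_trilinear[OF nn] trilinear_le_conc_env[OF nn] stu by (metis order_trans)
  qed
  have gap: "((\<lambda>x. conc_env p q r d (T x) - conv_env p q r d (T x)) has_integral
      d * (5 * d + 4 * (p + q + r) - 2 * min p (min q r)) / 24) ?K"
  proof -
    let ?g = "\<lambda>t. conc_env p q r d t - conv_env p q r d t"
    have "continuous_on UNIV ?g" by (intro continuous_intros cont)
    then have "integral ?K (\<lambda>(x, y, z). ?g ((x - a1) / d1, (y - a2) / d2, (z - a3) / d3))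
        = d1 * d2 * d3 * integral (cbox (0, 0, 0) (1, 1, 1)) ?g"
      by (rule integral_rescale_unit_cube[of ?g, OF _ dpos])
    also have "(\<lambda>(x, y, z). ?g ((x - a1) / d1, (y - a2) / d2, (z - a3) / d3)) = (\<lambda>x. ?g (T x))"
      by (auto simp: T_def fun_eq_iff)
    also have "integral (cbox (0, 0, 0) (1, 1, 1)) ?g = (5 * d + 4 * (p + q + r) - 2 * min p (min q r)) / 24"
      by (rule integral_unique[OF has_integral_envelope_gap])
    finally have "integral ?K (\<lambda>x. ?g (T x)) = d * (5 * d + 4 * (p + q + r) - 2 * min p (min q r)) / 24"
      by (simp add: ps)
    moreover have "(\<lambda>x. ?g (T x)) integrable_on ?K"
      by (intro integrable_continuous continuous_intros contT')
    ultimately show ?thesis by (intro iffD2[OF has_integral_iff] conjI)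
  qed
  have "measure lebesgue {(v, x). x \<in> ?K \<and> A (T x) + conv_env p q r d (T x) \<le> v \<and>
      v \<le> A (T x) + conc_env p q r d (T x)} = d * (5 * d + 4 * (p + q + r) - 2 * min p (min q r)) / 24"
  proof (rule measure_between_graphs)
    show "continuous_on ?K (\<lambda>x. A (T x) + conv_env p q r d (T x))"
      "continuous_on ?K (\<lambda>x. A (T x) + conc_env p q r d (T x))"
      by (intro continuous_intros contT')+
  qed (use le gap in \<open>simp_all add: compact_cbox\<close>)
  then show ?thesis
    using P_h_between_envelopes[OF a dpos] by (simp add: bs K ps T_def A_def)
next
  \<comment> \<open>A degenerate box gives a relaxation inside a hyperplane.\<close>
  case False
  then have "d = 0" using b by (auto simp: d_def)
  obtain k :: "real \<times> real \<times> real \<times> real" and c where k: "k \<noteq> 0"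
    and graph: "{(f, x1, x2, x3). f = x1 * x2 * x3 \<and> (x1, x2, x3) \<in> {a1..b1} \<times> {a2..b2} \<times> {a3..b3}}
      \<subseteq> {w. k \<bullet> w = c}"
  proof -
    consider "b1 = a1" | "b2 = a2" | "b3 = a3" using False b by linarith
    then show ?thesis
    proof cases
      case 1
      then show ?thesis by (intro that[of "(0, 1, 0, 0)" a1]) (auto simp: zero_prod_def)
    next
      case 2
      then show ?thesis by (intro that[of "(0, 0, 1, 0)" a2]) (auto simp: zero_prod_def)
    next
      case 3
      then show ?thesis by (intro that[of "(0, 0, 0, 1)" a3]) (auto simp: zero_prod_def)
    qed
  qed
  have "P_h ({a1..b1} \<times> {a2..b2} \<times> {a3..b3}) \<subseteq> {w. k \<bullet> w = c}"
    unfolding P_h_def by (intro hull_minimal graph convex_hyperplane)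
  then have "negligible (P_h ({a1..b1} \<times> {a2..b2} \<times> {a3..b3}))"
    using k by (auto intro: negligible_subset[OF negligible_hyperplane])
  then show ?thesis using \<open>d = 0\<close> by (simp add: negligible_imp_measure0)
qed

section \<open>The optimal branching point\<close>

text \<open>
  In a child with \<open>x\<^sub>1\<close> in \<open>{l..u}\<close> the three arguments of the minimum are \<open>E * l\<close>, \<open>F * (u - l)\<close> and
  \<open>G * (u - l)\<close>, in place of the ratios of the three variables. The condition \<open>a2 / b2 \<le> a3 / b3\<close>
  means \<open>F \<le> G\<close>, which removes the third one.
\<close>

lemma T1_eq:
  fixes a1 b1 a2 b2 a3 b3 c :: real
  defines "E \<equiv> (b2 - a2) * (b3 - a3)" and "F \<equiv> a2 * (b3 - a3)" and "G \<equiv> (b2 - a2) * a3"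
  defines "K \<equiv> 5 * E + 4 * F + 4 * G"
  assumes Om: "Omega a1 b1 a2 b2 a3 b3" and c: "c \<in> {a1..b1}"
  shows "T1 a1 b1 a2 b2 a3 b3 c = E / 24 *
    ((c - a1) * (K * (c - a1) + 4 * E * a1 - 2 * min (E * a1) (F * (c - a1)))
     + (b1 - c) * (K * (b1 - c) + 4 * E * c - 2 * min (E * c) (F * (b1 - c))))"
proof -
  have om: "0 \<le> a1" "a1 < b1" "0 \<le> a2" "a2 < b2" "0 \<le> a3" "a3 < b3"
    and r2: "a2 / b2 \<le> a3 / b3"
    using Om unfolding Omega_iff_ratios by auto
  have "a2 * b3 \<le> a3 * b2" using r2 om by (simp add: field_simps)
  then have FG: "F \<le> G" by (simp add: F_def G_def algebra_simps)
  have vol: "measure lebesgue (P_h ({l..u} \<times> {a2..b2} \<times> {a3..b3})) =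
      E / 24 * ((u - l) * (K * (u - l) + 4 * E * l - 2 * min (E * l) (F * (u - l))))"
    if "0 \<le> l" "l \<le> u" for l u
  proof -
    have "F * (u - l) \<le> G * (u - l)" using FG that by (intro mult_right_mono) auto
    then have min: "min (E * l) (min (F * (u - l)) (G * (u - l))) = min (E * l) (F * (u - l))"
      by simp
    have coeffs: "l * (b2 - a2) * (b3 - a3) = E * l" "(u - l) * a2 * (b3 - a3) = F * (u - l)"
      "(u - l) * (b2 - a2) * a3 = G * (u - l)" "(u - l) * (b2 - a2) * (b3 - a3) = E * (u - l)"
      by (simp_all add: E_def F_def G_def)
    have "measure lebesgue (P_h ({l..u} \<times> {a2..b2} \<times> {a3..b3})) =
        E * (u - l) * (5 * (E * (u - l)) + 4 * (E * l + F * (u - l) + G * (u - l))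
          - 2 * min (E * l) (F * (u - l))) / 24"
      using measure_P_h_box[of l a2 a3 u b2 b3] that om unfolding coeffs min by simp
    then show ?thesis by (simp add: K_def algebra_simps)
  qed
  show ?thesis
    unfolding T1_def using vol[of a1 c] vol[of c b1] c om by (simp add: distrib_left)
qed

text \<open>
  Because the minima enter with a negative sign, \<open>T\<close> is the pointwise maximum of four convex
  quadratics. So \<open>cs\<close> is optimal as soon as it is the vertex of a quadratic that attains the
  maximum there, or a point where two of them attain it, one with its vertex on the right and the
  other with its vertex on the left. The outcomes \<open>q2\<close> and \<open>q3\<close> of the procedure are of the first
  kind, the breakpoints of the second.
\<close>

lemma optimal_branching_point:
  fixes a1 b1 a2 b2 a3 b3 :: real
  defines "E \<equiv> (b2 - a2) * (b3 - a3)" and "F \<equiv> a2 * (b3 - a3)" and "G \<equiv> (b2 - a2) * a3"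
  defines "K \<equiv> 5 * E + 4 * F + 4 * G"
  defines "Q \<equiv> \<lambda>l r c. (c - a1) * (K * (c - a1) + 4 * E * a1 - 2 * l)
     + (b1 - c) * (K * (b1 - c) + 4 * E * c - 2 * r)"
  defines "T \<equiv> \<lambda>c. Q (min (E * a1) (F * (c - a1))) (min (E * c) (F * (b1 - c))) c"
  assumes Om: "Omega a1 b1 a2 b2 a3 b3"
  defines "cs \<equiv> c_star a1 b1 a2 b2 a3 b3"
  shows "cs \<in> {a1..b1}" "c \<in> {a1..b1} \<Longrightarrow> T cs \<le> T c"
proof -
  define m where "m = (a1 + b1) / 2"
  define h where "h = q3 a1 b1 a2 b2 a3 b3"
  have m2: "2 * m = a1 + b1" by (simp add: m_def)
  have q2: "q2 a1 b1 = m" by (simp add: m_def q2_def)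
  have om: "0 \<le> a1" "a1 < b1" "0 \<le> a2" "a2 < b2" "0 \<le> a3" "a3 < b3"
    and r1: "a1 / b1 \<le> a2 / b2"
    using Om unfolding Omega_iff_ratios by auto
  have pos: "0 < E" "0 \<le> F" "0 \<le> G"
    using om by (auto simp: E_def F_def G_def)
  then have K: "K \<ge> 5 * E + 4 * F" by (simp add: K_def)
  have r1': "a1 * b2 \<le> a2 * b1" using r1 om by (simp add: field_simps)
  have EF: "E * s \<le> F * t \<longleftrightarrow> s * b2 \<le> a2 * (s + t)"
    and FE: "F * t \<le> E * s \<longleftrightarrow> a2 * (s + t) \<le> s * b2" for s t
  proof -
    have "F * t - E * s = (b3 - a3) * (a2 * (s + t) - s * b2)"
      by (simp add: E_def F_def algebra_simps)
    then have "E * s \<le> F * t \<longleftrightarrow> 0 \<le> (b3 - a3) * (a2 * (s + t) - s * b2)"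
      "F * t \<le> E * s \<longleftrightarrow> (b3 - a3) * (a2 * (s + t) - s * b2) \<le> 0" by linarith+
    then show "E * s \<le> F * t \<longleftrightarrow> s * b2 \<le> a2 * (s + t)" "F * t \<le> E * s \<longleftrightarrow> a2 * (s + t) \<le> s * b2"
      using om by (simp_all add: zero_le_mult_iff mult_le_0_iff)
  qed
  \<comment> \<open>Any choice of arguments of the two minima gives a minorant of \<open>T\<close>. Each choice is a
    convex quadratic in \<open>c\<close>; for the three that decide the optimum, differences of values exhibit
    the leading coefficient and the vertex, which is \<open>m\<close> or \<open>h\<close>.\<close>
  have low: "Q l r c \<le> T c" if "c \<in> {a1..b1}" "l = E * a1 \<or> l = F * (c - a1)" "r = E * c \<or> r = F * (b1 - c)" for l r c
  proof -
    have "min (E * a1) (F * (c - a1)) \<le> l" "min (E * c) (F * (b1 - c)) \<le> r" using that by auto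
    then have "(c - a1) * min (E * a1) (F * (c - a1)) \<le> (c - a1) * l"
       "(b1 - c) * min (E * c) (F * (b1 - c)) \<le> (b1 - c) * r"
      using that(1) by (auto intro!: mult_left_mono)
    then show ?thesis unfolding T_def Q_def by (simp add: algebra_simps)
  qed
  have EE: "Q (E * a1) (E * c) c - Q (E * a1) (E * c') c' = (2 * K - 2 * E) * ((c - c') * (c + c' - 2 * m))" for c c'
    unfolding Q_def m2 by (simp add: algebra_simps)
  have FF: "Q (F * (c - a1)) (F * (b1 - c)) c - Q (F * (c' - a1)) (F * (b1 - c')) c'
      = (2 * K - 4 * E - 4 * F) * ((c - c') * (c + c' - 2 * m))" for c c'
    unfolding Q_def m2 by (simp add: algebra_simps)
  define k where "k = 2 * K - 4 * E - 2 * F"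
  have kpos: "k > 0" using K pos by (simp add: k_def)
  \<comment> \<open>The denominator of \<^const>\<open>q3\<close> is \<open>- k\<close>. With this identity \<open>h\<close> turns out to be the vertex of the
    quadratic in which the left child takes \<open>E * a1\<close> and the right child \<open>F * (b1 - c)\<close>.\<close>
  have hk: "k * (2 * h) = (2 * K - 4 * E) * (a1 + b1) + 2 * E * a1 - 4 * F * b1"
  proof -
    have "- (4 * a2 * a3 - b2 * a3 - 3 * b2 * b3) * 2 = k"
      by (simp add: k_def K_def E_def F_def G_def algebra_simps)
    then have k2: "2 * (4 * a2 * a3 - b2 * a3 - 3 * b2 * b3) = - k" by linarith
    have "k * (2 * h) = - 2 * (4 * a1 * a2 * a3 - 4 * a1 * b2 * b3 + 3 * b1 * a2 * a3 + b1 * a2 * b3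
        - b1 * b2 * a3 - 3 * b1 * b2 * b3)"
      unfolding h_def q3_def k2 using kpos by (simp add: field_simps)
    then show ?thesis
      by (simp add: k_def K_def E_def F_def G_def algebra_simps)
  qed
  have EFd: "Q (E * a1) (F * (b1 - c)) c - Q (E * a1) (F * (b1 - c')) c'
      = k * ((c - c') * (c + c' - 2 * h))" for c c'
  proof -
    have "Q (E * a1) (F * (b1 - c)) c - Q (E * a1) (F * (b1 - c')) c'
       = (c - c') * (k * (c + c') - ((2 * K - 4 * E) * (a1 + b1) + 2 * E * a1 - 4 * F * b1))"
      unfolding Q_def k_def by (simp add: algebra_simps)
    then show ?thesis unfolding hk[symmetric] by (simp add: algebra_simps)
  qed
  \<comment> \<open>A convex quadratic with vertex \<open>v\<close> does not increase from \<open>c\<close> to \<open>c'\<close> if \<open>c'\<close> lies between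
    \<open>c\<close> and \<open>v\<close>.\<close>
  have quad: "0 \<le> \<kappa> * ((c - c') * (c + c' - 2 * v))"
    if "0 \<le> \<kappa>" "c' = v \<or> (c \<le> c' \<and> c' \<le> v) \<or> (v \<le> c' \<and> c' \<le> c)" for \<kappa> c c' v :: real
  proof -
    have "0 \<le> (c - c') * (c + c' - 2 * v)"
      using that(2) by (auto simp: zero_le_mult_iff)
    then show ?thesis using that(1) by simp
  qed
  have coef: "0 \<le> 2 * K - 2 * E" "0 \<le> 2 * K - 4 * E - 4 * F" "0 \<le> k" using K pos kpos by auto
  \<comment> \<open>The claim amounts to \<open>a1 * (2 * K - 2 * E) \<le> b1 * (2 * K - 4 * E)\<close>. As \<open>a1 / b1 \<le> a2 / b2\<close>, it
    follows from the same inequality for \<open>a2\<close> and \<open>b2\<close>.\<close>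
  have hb: "h \<le> b1"
  proof -
    have "(2 * K - 4 * E) * (b2 - a2) \<ge> 2 * E * a2"
    proof -
      have "2 * E * a2 = 2 * F * (b2 - a2)" by (simp add: E_def F_def)
      moreover have "2 * F * (b2 - a2) \<le> (2 * K - 4 * E) * (b2 - a2)"
        using K pos om by (intro mult_right_mono) auto
      ultimately show ?thesis by simp
    qed
    then have "a2 * (2 * K - 2 * E) \<le> b2 * (2 * K - 4 * E)" by (simp add: algebra_simps)
    then have "b1 * (a2 * (2 * K - 2 * E)) \<le> b1 * (b2 * (2 * K - 4 * E))"
      using om by (intro mult_left_mono) auto
    moreover have "(a1 * b2) * (2 * K - 2 * E) \<le> (a2 * b1) * (2 * K - 2 * E)"
      using r1' coef by (intro mult_right_mono) auto
    ultimately have "b2 * (a1 * (2 * K - 2 * E)) \<le> b2 * (b1 * (2 * K - 4 * E))"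
      by (simp add: algebra_simps)
    then have "a1 * (2 * K - 2 * E) \<le> b1 * (2 * K - 4 * E)" using om by auto
    then have "k * (2 * h) \<le> k * (2 * b1)"
      unfolding hk by (simp add: k_def algebra_simps)
    then show ?thesis using kpos by simp
  qed
  have mab: "a1 \<le> m" "m \<le> b1" using om by (auto simp: m_def)
  have main: "cs \<in> {a1..b1} \<and> (c \<in> {a1..b1} \<longrightarrow> T cs \<le> T c)" for c
  proof (cases "a2 = 0")
    case True
    then have "cs = m" by (simp add: cs_def c_star_def q2)
    have "F = 0" "a1 = 0" using True r1' om by (auto simp: F_def zero_le_mult_iff mult_le_0_iff)
    then have Tm: "T m = Q (F * (m - a1)) (F * (b1 - m)) m"
      using pos mab by (simp add: T_def)
    have "T m \<le> T c" if "c \<in> {a1..b1}"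
      using low[OF that, of "F * (c - a1)" "F * (b1 - c)"] FF[of c m] quad[OF coef(2), of m m c] Tm by simp
    then show ?thesis using \<open>cs = m\<close> mab by simp
  next
    case False
    then have a2: "a2 > 0" and b2: "b2 > 0" using om by auto
    \<comment> \<open>From \<open>L\<close> upwards \<open>x\<^sub>1\<close> has the smallest ratio in the left child, up to \<open>R\<close> in the right one.\<close>
    define L where "L = a1 * b2 / a2"
    define R where "R = b1 * a2 / b2"
    have left: "E * a1 \<le> F * (c - a1) \<longleftrightarrow> L \<le> c" "F * (c - a1) \<le> E * a1 \<longleftrightarrow> c \<le> L" for c
      using EF[of a1 "c - a1"] FE[of "c - a1" a1] a2 by (simp_all add: L_def field_simps)
    have right: "E * c \<le> F * (b1 - c) \<longleftrightarrow> c \<le> R" "F * (b1 - c) \<le> E * c \<longleftrightarrow> R \<le> c" for c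
      using EF[of c "b1 - c"] FE[of "b1 - c" c] b2 by (simp_all add: R_def field_simps)
    have Lb: "a1 \<le> L" "L \<le> b1"
      using a2 om r1' by (auto simp: L_def field_simps intro: mult_left_mono)
    have Rb: "a1 \<le> R" "R \<le> b1"
      using b2 om r1' by (auto simp: R_def field_simps intro: mult_left_mono)
    \<comment> \<open>As \<open>L * R = a1 * b1\<close>, the midpoint is never below both breakpoints, so the optimum is
      never to the left of both.\<close>
    have LR: "L * R = a1 * b1" using a2 b2 by (simp add: L_def R_def)
    have amgm: "L * R \<le> m * m"
    proof -
      have "m * m - a1 * b1 = ((b1 - a1) / 2) * ((b1 - a1) / 2)" by (simp add: m_def field_simps)
      then show ?thesis using LR zero_le_square[of "(b1 - a1) / 2"] by linarith
    qed
    have mpos: "0 < m" using om by (simp add: m_def)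
    have minLR: "min L R \<le> m"
    proof (rule ccontr)
      assume "\<not> min L R \<le> m"
      then have "m < L" "m < R" by auto
      then have "m * m < L * R" using mpos by (intro mult_strict_mono) auto
      then show False using amgm by simp
    qed
    have TEE: "T c = Q (E * a1) (E * c) c" if "L \<le> c" "c \<le> R" for c
      using that by (simp add: T_def min_absorb1 left right)
    have TFF: "T c = Q (F * (c - a1)) (F * (b1 - c)) c" if "c \<le> L" "R \<le> c" for c
      using that by (simp add: T_def min_absorb2 left right)
    have TEF: "T c = Q (E * a1) (F * (b1 - c)) c" if "L \<le> c" "R \<le> c" for c
      using that by (simp add: T_def min_absorb1 min_absorb2 left right)
    have opt_h: "T h \<le> T c" if "L \<le> h" "R \<le> h" "c \<in> {a1..b1}" for c
      using low[OF that(3), of "E * a1" "F * (b1 - c)"] EFd[of c h] quad[OF coef(3), of h h c] TEF[OF that(1,2)]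
      by simp
    show ?thesis
    proof (cases "R \<le> L")
      case RL: True
      then have cs: "cs = (if h \<ge> L then h else if R \<le> m \<and> m \<le> L then m else L)"
        unfolding cs_def c_star_def using False by (simp add: q2 h_def L_def R_def)
      have Rm: "R \<le> m" using minLR RL by simp
      consider "L \<le> h" "cs = h" | "h < L" "m \<le> L" "cs = m" | "h < L" "L < m" "cs = L"
        using cs Rm by (metis not_le)
      then show ?thesis
      proof cases
        case 1
        then show ?thesis using opt_h RL Lb hb by auto
      next
        case 2
        have "T m \<le> T c" if "c \<in> {a1..b1}"
          using low[OF that, of "F * (c - a1)" "F * (b1 - c)"] FF[of c m] quad[OF coef(2), of m m c]
            TFF[OF 2(2) Rm] by simp
        then show ?thesis using 2 mab by simp
      next
        case 3
        \<comment> \<open>At the breakpoint two pieces meet: one still falls towards its vertex \<open>m\<close> on the right, the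
          other already rises away from its vertex \<open>h\<close> on the left.\<close>
        have "T L \<le> T c" if "c \<in> {a1..b1}"
        proof (cases "c \<le> L")
          case True
          then show ?thesis
            using low[OF that, of "F * (c - a1)" "F * (b1 - c)"] FF[of c L] quad[OF coef(2), of L m c]
            TFF[of L] RL 3 by simp
        next
          case False
          then show ?thesis
            using low[OF that, of "E * a1" "F * (b1 - c)"] EFd[of c L] quad[OF coef(3), of L h c]
            TEF[of L] RL 3 by simp
        qed
        then show ?thesis using 3 Lb by simp
      qed
    next
      case LR: False
      then have cs: "cs = (if h \<ge> R then h else if L \<le> m \<and> m \<le> R then m else R)"
        unfolding cs_def c_star_def using False by (simp add: q2 h_def L_def R_def)
      have Lm: "L \<le> m" using minLR LR by simp
      consider "R \<le> h" "cs = h" | "h < R" "m \<le> R" "cs = m" | "h < R" "R < m" "cs = R"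
        using cs Lm by (metis not_le)
      then show ?thesis
      proof cases
        case 1
        then show ?thesis using opt_h LR Rb hb by auto
      next
        case 2
        have "T m \<le> T c" if "c \<in> {a1..b1}"
          using low[OF that, of "E * a1" "E * c"] EE[of c m] quad[OF coef(1), of m m c]
            TEE[OF Lm 2(2)] by simp
        then show ?thesis using 2 mab by simp
      next
        case 3
        have "T R \<le> T c" if "c \<in> {a1..b1}"
        proof (cases "c \<le> R")
          case True
          then show ?thesis
            using low[OF that, of "E * a1" "E * c"] EE[of c R] quad[OF coef(1), of R m c]
            TEE[of R] LR 3 by simp
        next
          case False
          then show ?thesis
            using low[OF that, of "E * a1" "F * (b1 - c)"] EFd[of c R] quad[OF coef(3), of R h c]
            TEF[of R] LR 3 by simp
        qed
        then show ?thesis using 3 Rb by simp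
      qed
    qed
  qed
  show "cs \<in> {a1..b1}" "c \<in> {a1..b1} \<Longrightarrow> T cs \<le> T c" using main by auto
qed

theorem theorem2:
  fixes a1 b1 a2 b2 a3 b3 :: real
  assumes "Omega a1 b1 a2 b2 a3 b3"
  shows "c_star a1 b1 a2 b2 a3 b3 \<in> {a1..b1} \<and>
    (\<forall>c1 \<in> {a1..b1}. T1 a1 b1 a2 b2 a3 b3 (c_star a1 b1 a2 b2 a3 b3) \<le> T1 a1 b1 a2 b2 a3 b3 c1)"
proof (intro conjI ballI)
  show mem: "c_star a1 b1 a2 b2 a3 b3 \<in> {a1..b1}"
    using assms by (rule optimal_branching_point)
  fix c1 assume c1: "c1 \<in> {a1..b1}"
  have "0 \<le> (b2 - a2) * (b3 - a3) / 24" using assms by (simp add: Omega_def)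
  then show "T1 a1 b1 a2 b2 a3 b3 (c_star a1 b1 a2 b2 a3 b3) \<le> T1 a1 b1 a2 b2 a3 b3 c1"
    unfolding T1_eq[OF assms mem] T1_eq[OF assms c1]
    by (intro mult_left_mono optimal_branching_point(2)[OF assms c1])
qed

end
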